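(* Let $\mathrm{a}_{n,k}^{\mathrm{dasc}}(132,321)$ denote the number of permutations of $\{1,\dots,n\}$ that avoid both $132$ and $321$ and have exactly $k$ double ascents. Then $$\mathrm{a}_{n,k}^{\mathrm{dasc}}(132,321)=\begin{cases}1,&k=n-2;\\ n,&k=n-3;\\ \binom{n}{2}-n,&k=n-4;\\ 0,&\text{otherwise}.\end{cases}$$
   Context: $\mathcal{S}_n$ is the set of permutations $\pi=\pi_1\cdots\pi_n$ of $\{1,\dots,n\}$. For $\rho\in\mathcal{S}_m$, $\pi\in\mathcal{S}_n$ contains $\rho$ if there are indices $1\le i_1<\cdots<i_m\le n$ such that $\pi_{i_a}<\pi_{i_b}$ if and only if $\rho_a<\rho_b$; otherwise $\pi$ avoids $\rho$. The number of double ascents is $\mathrm{dasc}(\pi)=|\{i:\pi_i<\pi_{i+1}\text{ and }\pi_{i+1}<\pi_{i+2}\}|$, where $1\le i\le n-2$.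
   Formalization: The formal statement assumes n ≥ 3; the formula fails for n ≤ 2 (for n = 2 both 12 and 21 avoid the patterns with 0 double ascents, so the count at k = 0 is 2, not 1; for n = 0 and n = 1 the count at k = 0 is 1, not 0). *)

theory Defs
  imports Main "HOL-Combinatorics.Multiset_Permutations"
begin

text \<open>
  A permutation \<open>\<pi> = \<pi>\<^sub>1 \<dots> \<pi>\<^sub>n\<close> is its one-line notation, i.e. a list without
  repetitions whose set of entries is \<open>{1..n}\<close>. List positions are 0-based, so
  \<open>\<pi>\<^sub>i\<close> is \<open>\<pi> ! (i - 1)\<close>.
\<close>

definition perms :: "nat \<Rightarrow> nat list set" where
  "perms n = permutations_of_set {1..n}"

definition contains_pattern :: "nat list \<Rightarrow> nat list \<Rightarrow> bool" where
  "contains_pattern \<pi> \<rho> \<longleftrightarrow>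
     (\<exists>i :: nat \<Rightarrow> nat.
        strict_mono_on {..<length \<rho>} i \<and>
        (\<forall>a<length \<rho>. i a < length \<pi>) \<and>
        (\<forall>a<length \<rho>. \<forall>b<length \<rho>. \<pi> ! i a < \<pi> ! i b \<longleftrightarrow> \<rho> ! a < \<rho> ! b))"

abbreviation avoids_pattern :: "nat list \<Rightarrow> nat list \<Rightarrow> bool" where
  "avoids_pattern \<pi> \<rho> \<equiv> \<not> contains_pattern \<pi> \<rho>"

definition dasc :: "nat list \<Rightarrow> nat" where
  "dasc \<pi> =
     card {i. i + 2 < length \<pi> \<and> \<pi> ! i < \<pi> ! (i + 1) \<and> \<pi> ! (i + 1) < \<pi> ! (i + 2)}"

definition a_dasc :: "nat \<Rightarrow> nat \<Rightarrow> nat list \<Rightarrow> nat list \<Rightarrow> nat" where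
  "a_dasc n k \<rho> \<sigma> =
     card {\<pi> \<in> perms n. avoids_pattern \<pi> \<rho> \<and> avoids_pattern \<pi> \<sigma> \<and> dasc \<pi> = k}"

end

theory Submission
  imports Defs
begin

text \<open>
  If a permutation of \<open>{1..n}\<close> avoiding 132 and 321 does not end with \<open>n\<close>, then avoiding 132
  puts all entries before \<open>n\<close> above all entries after it, and avoiding 321 then forces both
  blocks to be increasing, so the permutation is a rotation of \<open>1 2 \<dots> n\<close>. If it ends with
  \<open>n\<close>, delete \<open>n\<close> and repeat. Hence the avoiders are the identity and the permutations
  \<open>(j+1) \<dots> (j+p) 1 \<dots> j (j+p+1) \<dots> n\<close> with \<open>p, j \<ge> 1\<close> and \<open>p + j \<le> n\<close>. Such a
  permutation has a single descent, at position \<open>p\<close>, which destroys two of the \<open>n - 2\<close> double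
  ascents, or only one if \<open>p = 1\<close> or \<open>p = n - 1\<close>.
\<close>

section \<open>Patterns of length three as inequalities between entries\<close>

lemma contains_pattern_length3:
  "contains_pattern \<pi> [x, y, z] \<longleftrightarrow>
    (\<exists>a b c. a < b \<and> b < c \<and> c < length \<pi> \<and>
      (\<pi> ! a < \<pi> ! b \<longleftrightarrow> x < y) \<and> (\<pi> ! b < \<pi> ! a \<longleftrightarrow> y < x) \<and>
      (\<pi> ! a < \<pi> ! c \<longleftrightarrow> x < z) \<and> (\<pi> ! c < \<pi> ! a \<longleftrightarrow> z < x) \<and>
      (\<pi> ! b < \<pi> ! c \<longleftrightarrow> y < z) \<and> (\<pi> ! c < \<pi> ! b \<longleftrightarrow> z < y))"
  (is "?L \<longleftrightarrow> ?R")
proof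
  assume ?L
  then obtain i where mono: "strict_mono_on {..<3} i"
    and len: "\<forall>a<3. i a < length \<pi>"
    and ord: "\<forall>a<3. \<forall>b<3. \<pi> ! i a < \<pi> ! i b \<longleftrightarrow> [x, y, z] ! a < [x, y, z] ! b"
    by (auto simp: contains_pattern_def numeral_3_eq_3)
  have "i 0 < i 1" "i 1 < i 2"
    using mono by (auto simp: strict_mono_on_def)
  moreover have "i 2 < length \<pi>" using len by simp
  ultimately show ?R
    using ord[rule_format, of 0 1] ord[rule_format, of 1 0] ord[rule_format, of 0 2]
      ord[rule_format, of 2 0] ord[rule_format, of 1 2] ord[rule_format, of 2 1]
    by (intro exI[of _ "i 0"] exI[of _ "i 1"] exI[of _ "i 2"]) simp
next
  assume ?R
  then obtain a b c where abc: "a < b" "b < c" "c < length \<pi>"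
    "\<pi> ! a < \<pi> ! b \<longleftrightarrow> x < y" "\<pi> ! b < \<pi> ! a \<longleftrightarrow> y < x"
    "\<pi> ! a < \<pi> ! c \<longleftrightarrow> x < z" "\<pi> ! c < \<pi> ! a \<longleftrightarrow> z < x"
    "\<pi> ! b < \<pi> ! c \<longleftrightarrow> y < z" "\<pi> ! c < \<pi> ! b \<longleftrightarrow> z < y"
    by blast
  define i :: "nat \<Rightarrow> nat" where "i m = (if m = 0 then a else if m = 1 then b else c)" for m
  have all3: "(\<forall>m<3. P m) \<longleftrightarrow> P 0 \<and> P 1 \<and> P 2" for P :: "nat \<Rightarrow> bool"
    by (auto simp: numeral_eq_Suc less_Suc_eq)
  have len: "length [x, y, z] = 3" by simp
  have "strict_mono_on {..<3} i"
    using abc(1,2) by (auto simp: strict_mono_on_def i_def)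
  moreover have "\<forall>m<3. i m < length \<pi>"
    using abc(1-3) by (simp add: i_def)
  moreover have "\<forall>m<3. \<forall>l<3. \<pi> ! i m < \<pi> ! i l \<longleftrightarrow> [x, y, z] ! m < [x, y, z] ! l"
    unfolding all3 using abc(4-9) by (simp add: i_def)
  ultimately show ?L
    unfolding contains_pattern_def len by blast
qed

text \<open>Two inequalities suffice: the third comparison follows by transitivity, and the reversed
  ones fail by asymmetry.\<close>

lemma contains_132_iff:
  "contains_pattern \<pi> [1, 3, 2] \<longleftrightarrow>
    (\<exists>a b c. a < b \<and> b < c \<and> c < length \<pi> \<and> \<pi> ! a < \<pi> ! c \<and> \<pi> ! c < \<pi> ! b)"
  unfolding contains_pattern_length3 by (rule ex_cong1)+ auto

lemma contains_321_iff:
  "contains_pattern \<pi> [3, 2, 1] \<longleftrightarrow>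
    (\<exists>a b c. a < b \<and> b < c \<and> c < length \<pi> \<and> \<pi> ! c < \<pi> ! b \<and> \<pi> ! b < \<pi> ! a)"
  unfolding contains_pattern_length3 by (rule ex_cong1)+ auto

definition avoids_132_321 :: "nat list \<Rightarrow> bool" where
  "avoids_132_321 \<pi> \<longleftrightarrow> avoids_pattern \<pi> [1, 3, 2] \<and> avoids_pattern \<pi> [3, 2, 1]"

lemma avoids_132_321D:
  assumes "avoids_132_321 \<pi>" "a < b" "b < c" "c < length \<pi>"
  shows "\<not> (\<pi> ! a < \<pi> ! c \<and> \<pi> ! c < \<pi> ! b)" "\<not> (\<pi> ! c < \<pi> ! b \<and> \<pi> ! b < \<pi> ! a)"
  using assms unfolding avoids_132_321_def contains_132_iff contains_321_iff by blast+

text \<open>An occurrence in a prefix sits at the same positions of the whole list. This permits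
  deleting a final maximum in the induction.\<close>

lemma avoids_132_321_appendD:
  assumes "avoids_132_321 (xs @ ys)"
  shows "avoids_132_321 xs"
  unfolding avoids_132_321_def contains_132_iff contains_321_iff
  using avoids_132_321D[OF assms]
  by (fastforce simp: nth_append)

section \<open>The identity with a rotated initial segment\<close>

definition rotated_prefix :: "nat \<Rightarrow> nat \<Rightarrow> nat \<Rightarrow> nat list" where
  "rotated_prefix n p j = [j + 1..<j + p + 1] @ [1..<j + 1] @ [j + p + 1..<n + 1]"

definition rotation_params :: "nat \<Rightarrow> (nat \<times> nat) set" where
  "rotation_params n = {(p, j). 1 \<le> p \<and> 1 \<le> j \<and> p + j \<le> n}"

lemma length_rotated_prefix:
  "p + j \<le> n \<Longrightarrow> length (rotated_prefix n p j) = n"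
  by (simp add: rotated_prefix_def del: upt_Suc)

lemma nth_rotated_prefix:
  assumes "p + j \<le> n" "i < n"
  shows "rotated_prefix n p j ! i =
    (if i < p then i + j + 1 else if i < p + j then i - p + 1 else i + 1)"
  using assms by (auto simp: rotated_prefix_def nth_append simp del: upt_Suc)

lemma rotated_prefix_in_perms:
  assumes "p + j \<le> n"
  shows "rotated_prefix n p j \<in> perms n"
  using assms
  by (auto simp: perms_def permutations_of_set_def rotated_prefix_def simp del: upt_Suc)

lemma upt_in_perms: "[1..<n + 1] \<in> perms n"
  by (auto simp: perms_def permutations_of_set_def simp del: upt_Suc)

lemma rotated_prefix_avoids:
  assumes "p + j \<le> n"
  shows "avoids_132_321 (rotated_prefix n p j)"
  unfolding avoids_132_321_def contains_132_iff contains_321_iff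
  using assms
  by (auto simp: length_rotated_prefix nth_rotated_prefix split: if_splits)

lemma upt_avoids: "avoids_132_321 [1..<n + 1]"
  unfolding avoids_132_321_def contains_132_iff contains_321_iff
  by (auto simp del: upt_Suc)

section \<open>Classification of the avoiders\<close>

lemma avoider_with_inner_maximum:
  assumes perm: "xs @ n # ys \<in> perms n" and av: "avoids_132_321 (xs @ n # ys)"
    and ne: "ys \<noteq> []"
  shows "\<exists>(p, j) \<in> rotation_params n. xs @ n # ys = rotated_prefix n p j"
proof -
  let ?\<pi> = "xs @ n # ys"
  have dist: "distinct ?\<pi>" and set: "set ?\<pi> = {1..n}"
    using perm by (auto simp: perms_def permutations_of_set_def)
  have small: "z < n" if "z \<in> set xs \<union> set ys" for z
    using that dist set by (fastforce simp: le_less)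
  have above: "y < x" if x: "x \<in> set xs" and y: "y \<in> set ys" for x y
  proof -
    from x obtain a where a: "a < length xs" "xs ! a = x" by (auto simp: in_set_conv_nth)
    from y obtain c where c: "c < length ys" "ys ! c = y" by (auto simp: in_set_conv_nth)
    \<comment> \<open>Otherwise \<open>x\<close>, \<open>n\<close>, \<open>y\<close> would form a
      132; the maximum has index \<open>length xs\<close>, and \<open>ys\<close> starts one place
      later.\<close>
    have "\<not> (x < y \<and> y < n)"
      using avoids_132_321D(1)[OF av, of a "length xs" "Suc (length xs) + c"] a c
      by (simp add: nth_append)
    moreover have "x \<noteq> y" using dist x y by auto
    ultimately show ?thesis using small y by force
  qed
  have sys: "sorted_wrt (<) ys"
    unfolding sorted_wrt_iff_nth_less
  proof (intro allI impI)
    fix b c assume bc: "b < c" "c < length ys"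
    \<comment> \<open>A descending pair in \<open>ys\<close> would form a 321 together with
      \<open>n\<close>.\<close>
    have "\<not> (ys ! c < ys ! b \<and> ys ! b < n)"
      using avoids_132_321D(2)[OF av, of "length xs" "Suc (length xs) + b" "Suc (length xs) + c"] bc
      by (simp add: nth_append)
    moreover have "ys ! b < n" using bc small by simp
    moreover have "ys ! b \<noteq> ys ! c" using dist bc by (simp add: nth_eq_iff_index_eq)
    ultimately show "ys ! b < ys ! c" by linarith
  qed
  have sxs: "sorted_wrt (<) xs"
    unfolding sorted_wrt_iff_nth_less
  proof (intro allI impI)
    fix a b assume ab: "a < b" "b < length xs"
    \<comment> \<open>Here the first entry of \<open>ys\<close>, which lies below all of
      \<open>xs\<close>, serves as the 1 of a 321.\<close>
    have "\<not> (ys ! 0 < xs ! b \<and> xs ! b < xs ! a)"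
      using avoids_132_321D(2)[OF av, of a b "Suc (length xs)"] ab ne
      by (simp add: nth_append)
    moreover have "ys ! 0 < xs ! b" using ab ne above by simp
    moreover have "xs ! a \<noteq> xs ! b" using dist ab by (simp add: nth_eq_iff_index_eq)
    ultimately show "xs ! a < xs ! b" by linarith
  qed
  \<comment> \<open>Moving \<open>ys\<close> to the front sorts the permutation. A sorted list of
    distinct entries is determined by its set, so the result is the identity, and its initial and
    final segments give \<open>ys\<close> and \<open>xs @ [n]\<close>.\<close>
  have "sorted_wrt (<) (ys @ xs @ [n])"
    using sys sxs above small by (auto simp: sorted_wrt_append)
  moreover have "set (ys @ xs @ [n]) = set ?\<pi>" by auto
  ultimately have id: "ys @ xs @ [n] = [1..<n + 1]"
    by (intro sorted_distinct_set_unique)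
      (simp_all only: strict_sorted_iff set set_upt sorted_upt distinct_upt
        Suc_eq_plus1[symmetric] atLeastLessThanSuc_atLeastAtMost)
  define j where "j = length ys"
  define p where "p = length xs + 1"
  have pj: "p + j = n"
    using arg_cong[OF id, of length] by (simp add: j_def p_def del: upt_Suc)
  have "ys = [1..<j + 1]"
    using arg_cong[OF id, of "take j"] pj by (simp add: j_def take_upt del: upt_Suc)
  moreover have "xs @ [n] = [j + 1..<n + 1]"
    using arg_cong[OF id, of "drop j"] by (simp add: j_def drop_upt del: upt_Suc)
  ultimately have "?\<pi> = rotated_prefix n p j"
    using pj by (simp add: rotated_prefix_def add.commute del: upt_Suc)
  moreover have "1 \<le> p" "1 \<le> j" using ne by (simp_all add: p_def j_def Suc_le_eq)
  ultimately show ?thesis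
    using pj by (intro bexI[of _ "(p, j)"]) (auto simp: rotation_params_def)
qed

lemma avoider_cases:
  assumes "\<pi> \<in> perms n" "avoids_132_321 \<pi>"
  shows "\<pi> = [1..<n + 1] \<or> (\<exists>(p, j) \<in> rotation_params n. \<pi> = rotated_prefix n p j)"
  using assms
proof (induction n arbitrary: \<pi>)
  case 0
  then show ?case by (simp add: perms_def)
next
  case (Suc n)
  have dist: "distinct \<pi>" and set: "set \<pi> = {1..Suc n}"
    using Suc.prems(1) by (auto simp: perms_def permutations_of_set_def)
  then have "Suc n \<in> set \<pi>" by simp
  then obtain xs ys where \<pi>: "\<pi> = xs @ Suc n # ys" by (metis split_list)
  show ?case
  proof (cases "ys = []")
    case False
    then show ?thesis
      using avoider_with_inner_maximum[of xs "Suc n" ys] Suc.prems \<pi> by auto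
  next
    case True
    have "set xs = set \<pi> - {Suc n}" using dist \<pi> True by auto
    also have "\<dots> = {1..n}" unfolding set by auto
    finally have "xs \<in> perms n"
      using dist \<pi> by (auto simp: perms_def permutations_of_set_def)
    moreover have "avoids_132_321 xs"
      using Suc.prems(2) \<pi> by (blast intro: avoids_132_321_appendD)
    ultimately consider "xs = [1..<n + 1]"
      | p j where "(p, j) \<in> rotation_params n" "xs = rotated_prefix n p j"
      using Suc.IH by blast
    then show ?thesis
    proof cases
      case 1
      then show ?thesis using \<pi> True by simp
    next
      case 2
      \<comment> \<open>The restored maximum only lengthens the third, fixed block.\<close>
      then have "\<pi> = rotated_prefix (Suc n) p j" "(p, j) \<in> rotation_params (Suc n)"
        using \<pi> True by (auto simp: rotated_prefix_def rotation_params_def)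
      then show ?thesis by blast
    qed
  qed
qed

lemma avoiders_eq:
  "{\<pi> \<in> perms n. avoids_132_321 \<pi>} =
    insert [1..<n + 1] ((\<lambda>(p, j). rotated_prefix n p j) ` rotation_params n)"
  using avoider_cases upt_in_perms upt_avoids rotated_prefix_in_perms rotated_prefix_avoids
  by (fastforce simp: rotation_params_def simp del: upt_Suc)

text \<open>The first entry is \<open>j + 1\<close>, which recovers \<open>j\<close>; the entry 1
  has 0-based index \<open>p\<close>, which recovers \<open>p\<close>.\<close>

lemma inj_on_rotated_prefix:
  "inj_on (\<lambda>(p, j). rotated_prefix n p j) (rotation_params n)"
proof -
  have eq: "p = p' \<and> j = j'"
    if "(p, j) \<in> rotation_params n" "(p', j') \<in> rotation_params n"
      and eq: "rotated_prefix n p j = rotated_prefix n p' j'" for p j p' j'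
  proof -
    have *: "1 \<le> p" "1 \<le> j" "p + j \<le> n" "1 \<le> p'" "1 \<le> j'" "p' + j' \<le> n"
      using that by (auto simp: rotation_params_def)
    have "j = j'"
      using * arg_cong[OF eq, of "\<lambda>xs. xs ! 0"] by (simp add: nth_rotated_prefix)
    moreover have "\<not> p < p'"
    proof
      assume "p < p'"
      then have "rotated_prefix n p j ! p = 1" "rotated_prefix n p' j' ! p \<noteq> 1"
        using * by (simp_all add: nth_rotated_prefix)
      then show False using eq by simp
    qed
    moreover have "\<not> p' < p"
    proof
      assume "p' < p"
      then have "rotated_prefix n p' j' ! p' = 1" "rotated_prefix n p j ! p' \<noteq> 1"
        using * by (simp_all add: nth_rotated_prefix)
      then show False using eq by simp
    qed
    ultimately show ?thesis by simp
  qed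
  show ?thesis by (rule inj_onI) (use eq in force)
qed

section \<open>Double ascents of the avoiders\<close>

lemma dasc_upt: "dasc [1..<n + 1] = n - 2"
proof -
  have "{i. i + 2 < length [1..<n + 1] \<and> [1..<n + 1] ! i < [1..<n + 1] ! (i + 1) \<and>
      [1..<n + 1] ! (i + 1) < [1..<n + 1] ! (i + 2)} = {..<n - 2}"
    by (auto simp del: upt_Suc)
  then show ?thesis by (simp add: dasc_def del: upt_Suc)
qed

text \<open>The only descent lies between the 0-based positions \<open>p - 1\<close> and
  \<open>p\<close>, so exactly the triples starting at \<open>p - 2\<close> and \<open>p - 1\<close>
  fail. The former does not exist if \<open>p = 1\<close>, the latter if \<open>p = n - 1\<close>;
  these cases are distinct since \<open>n \<ge> 3\<close>.\<close>

lemma dasc_rotated_prefix: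
  assumes "n \<ge> 3" "(p, j) \<in> rotation_params n"
  shows "dasc (rotated_prefix n p j) = (if p = 1 \<or> p = n - 1 then n - 3 else n - 4)"
proof -
  have p: "1 \<le> p" "1 \<le> j" "p + j \<le> n" using assms by (auto simp: rotation_params_def)
  let ?\<pi> = "rotated_prefix n p j"
  have "{i. i + 2 < length ?\<pi> \<and> ?\<pi> ! i < ?\<pi> ! (i + 1) \<and> ?\<pi> ! (i + 1) < ?\<pi> ! (i + 2)} =
      {i. i + 2 < n \<and> i + 1 \<noteq> p \<and> i + 2 \<noteq> p}"
    using p by (auto simp: length_rotated_prefix nth_rotated_prefix split: if_splits)
  also have "\<dots> = {..<n - 2} -
      (if p = 1 then {0} else if p = n - 1 then {n - 3} else {p - 2, p - 1})"
    using p assms(1) by auto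
  also have "card \<dots> = (if p = 1 \<or> p = n - 1 then n - 3 else n - 4)"
    using p assms(1) by (auto simp: card_Diff_subset)
  finally show ?thesis by (simp add: dasc_def)
qed

section \<open>Counting the parameter pairs\<close>

lemma rotation_params_eq_Sigma:
  "rotation_params n = Sigma {1..<n} (\<lambda>p. {1..n - p})"
  by (auto simp: rotation_params_def)

lemma finite_rotation_params: "finite (rotation_params n)"
  by (simp add: rotation_params_eq_Sigma)

lemma card_rotation_params: "card (rotation_params n) = n choose 2"
proof -
  have "card (rotation_params n) = (\<Sum>p = 1..<n. n - p)"
    by (simp add: rotation_params_eq_Sigma)
  also have "\<dots> = (\<Sum>p = 1..<n. p)"
    by (rule sum.reindex_bij_witness[of _ "\<lambda>p. n - p" "\<lambda>p. n - p"]) auto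
  also have "\<dots> = (\<Sum>p<n. p)"
    by (rule sum.mono_neutral_left) auto
  also have "\<dots> = n choose 2"
    by (induction n) (simp_all add: numeral_2_eq_2)
  finally show ?thesis .
qed

text \<open>For \<open>p = 1\<close> there are \<open>n - 1\<close> choices of \<open>j\<close>,
  while \<open>p = n - 1\<close> forces \<open>j = 1\<close>.\<close>

lemma card_rotation_params_extremal:
  assumes "n \<ge> 3"
  shows "card {(p, j) \<in> rotation_params n. p = 1 \<or> p = n - 1} = n"
proof -
  have "{(p, j) \<in> rotation_params n. p = 1 \<or> p = n - 1} =
      insert (n - 1, 1) ({1} \<times> {1..n - 1})"
    using assms by (auto simp: rotation_params_def)
  then show ?thesis using assms by simp
qed

section \<open>Distribution of double ascents over the avoiders\<close>

lemma a_dasc_eq_card_rotation_params: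
  assumes "n \<ge> 3"
  shows "a_dasc n k [1, 3, 2] [3, 2, 1] =
    (if k = n - 2 then 1 else 0) +
    card {(p, j) \<in> rotation_params n. (if p = 1 \<or> p = n - 1 then n - 3 else n - 4) = k}"
proof -
  let ?f = "\<lambda>(p, j). rotated_prefix n p j"
  let ?T = "{(p, j) \<in> rotation_params n. (if p = 1 \<or> p = n - 1 then n - 3 else n - 4) = k}"
  let ?I = "if k = n - 2 then {[1..<n + 1]} else {}"
  have "{\<pi> \<in> perms n. avoids_132_321 \<pi> \<and> dasc \<pi> = k} =
      {\<pi> \<in> {\<pi> \<in> perms n. avoids_132_321 \<pi>}. dasc \<pi> = k}" by blast
  also have "\<dots> = ?I \<union> ?f ` ?T"
    unfolding avoiders_eq using dasc_rotated_prefix[OF assms] dasc_upt[of n]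
    by (auto simp del: upt_Suc)
  finally have split: "{\<pi> \<in> perms n. avoids_132_321 \<pi> \<and> dasc \<pi> = k} = ?I \<union> ?f ` ?T" .
  have sub: "?T \<subseteq> rotation_params n" by auto
  \<comment> \<open>Double ascents tell them apart: the identity has \<open>n - 2\<close>, a rotated
    prefix at most \<open>n - 3\<close>.\<close>
  have "[1..<n + 1] \<noteq> rotated_prefix n p j" if "(p, j) \<in> rotation_params n" for p j
    using dasc_rotated_prefix[OF assms that] dasc_upt[of n] assms
    by (auto split: if_splits simp del: upt_Suc)
  then have disj: "?I \<inter> ?f ` ?T = {}" by (auto simp del: upt_Suc)
  have "a_dasc n k [1, 3, 2] [3, 2, 1] = card (?I \<union> ?f ` ?T)"
    unfolding split[symmetric] a_dasc_def avoids_132_321_def conj_assoc ..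
  also have "\<dots> = card ?I + card (?f ` ?T)"
    by (rule card_Un_disjoint[OF _ finite_imageI[OF finite_subset[OF sub finite_rotation_params]] disj])
      simp
  also have "\<dots> = card ?I + card ?T"
    by (simp only: card_image[OF inj_on_subset[OF inj_on_rotated_prefix sub]])
  also have "card ?I = (if k = n - 2 then 1 else 0)" by simp
  finally show ?thesis .
qed

text \<open>Over the integers, \<open>n - 4\<close> is negative for \<open>n = 3\<close> and matches
  no \<open>k\<close>. The bound \<open>n \<ge> 3\<close> matters: for \<open>n = 2\<close> both
  permutations avoid the patterns and have no double ascent, so the count at \<open>k = 0\<close> is
  2, not 1.\<close>

theorem proposition22:
  fixes n k :: nat
  assumes "n \<ge> 3"
  shows "int (a_dasc n k [1, 3, 2] [3, 2, 1]) =
    (if int k = int n - 2 then 1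
     else if int k = int n - 3 then int n
     else if int k = int n - 4 then int (n choose 2) - int n
     else 0)"
proof -
  let ?E = "{(p, j) \<in> rotation_params n. p = 1 \<or> p = n - 1}"
  let ?T = "{(p, j) \<in> rotation_params n. (if p = 1 \<or> p = n - 1 then n - 3 else n - 4) = k}"
  have E: "card ?E = n" by (rule card_rotation_params_extremal[OF assms])
  have sub: "?E \<subseteq> rotation_params n" by auto
  have rest: "card (rotation_params n - ?E) = (n choose 2) - n"
    using card_Diff_subset[OF finite_subset[OF sub finite_rotation_params] sub] E
      card_rotation_params by simp
  \<comment> \<open>This makes the truncated difference in \<open>rest\<close> agree with the
    integer one.\<close>
  have le: "n \<le> n choose 2"
    using card_mono[OF finite_rotation_params sub] E card_rotation_params by simp
  \<comment> \<open>For \<open>n = 3\<close> the truncated \<open>n - 4\<close> equals \<open>n - 3\<close>, but then every parameter pair is extremal.\<close>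
  have small: "?E = rotation_params n" if "n = 3"
    using that by (auto simp: rotation_params_def)
  consider "k = n - 2" | "k = n - 3" | "n \<ge> 4" "k = n - 4"
    | "k \<noteq> n - 2" "k \<noteq> n - 3" "k \<noteq> n - 4"
    using assms by linarith
  then show ?thesis
  proof cases
    case 1
    then have T: "?T = {}" using assms by auto
    show ?thesis
      unfolding a_dasc_eq_card_rotation_params[OF assms] T
      using 1 assms by simp
  next
    case 2
    have T: "?T = ?E"
    proof (cases "n = 3")
      case True
      then show ?thesis using small 2 by auto
    next
      case False
      then show ?thesis using 2 assms by (auto split: if_splits)
    qed
    show ?thesis
      unfolding a_dasc_eq_card_rotation_params[OF assms] T E
      using 2 assms by simp
  next
    case 3
    then have T: "?T = rotation_params n - ?E" by (auto split: if_splits)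
    show ?thesis
      unfolding a_dasc_eq_card_rotation_params[OF assms] T rest
      using 3 le by (simp add: of_nat_diff)
  next
    case 4
    then have T: "?T = {}" by auto
    show ?thesis
      unfolding a_dasc_eq_card_rotation_params[OF assms] T
      using 4 assms by auto
  qed
qed

end
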